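(* Let $S_{\mathrm A} = \bigcup_{k \ge 2,\ k \text{ even}} \left((2^{k-1}, 2^k] \cap \mathbb{Z}^+\right)$. Then $S_{\mathrm A}$ is not $3$-permutable: it admits no permutation of order type $\omega$ free of monotone $3$-term arithmetic progressions. In particular, putting $S_{\mathrm B} = \mathbb{Z}^+ \setminus S_{\mathrm A}$, the partition $\mathbb{Z}^+ = S_{\mathrm A} \sqcup S_{\mathrm B}$ is not a partition of $\mathbb{Z}^+$ into two $3$-permutable sets.
   Context: $\mathbb{N} = \{1,2,3,\dots\} = \mathbb{Z}^+$. A set $S \subseteq \mathbb{Z}^+$ is permutable (synonymously, $3$-permutable) if there is a bijection $\pi\colon \mathbb{N} \to S$ (a permutation of $S$ of order type $\omega$) such that no $i<j<k$ have $\pi(i),\pi(j),\pi(k)$ forming a $3$-term arithmetic progression with $\pi(i)<\pi(j)<\pi(k)$ or $\pi(i)>\pi(j)>\pi(k)$; such a triple is called a monotone $3$-term arithmetic progression. *)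

theory Defs
  imports Main "HOL-Library.Disjoint_Sets"
begin

text \<open>The positive integers are the elements of \<open>{1..}\<close> in type \<^typ>\<open>nat\<close>.\<close>

text \<open>The common difference is an integer, so decreasing progressions are included.\<close>

definition ap3 :: "nat \<Rightarrow> nat \<Rightarrow> nat \<Rightarrow> bool" where
  "ap3 a b c \<longleftrightarrow> int b - int a = int c - int b"

definition monotone_ap3 :: "nat \<Rightarrow> nat \<Rightarrow> nat \<Rightarrow> bool" where
  "monotone_ap3 a b c \<longleftrightarrow> ap3 a b c \<and> (a < b \<and> b < c \<or> a > b \<and> b > c)"

definition omega_permutation :: "(nat \<Rightarrow> nat) \<Rightarrow> nat set \<Rightarrow> bool" where
  "omega_permutation \<pi> S \<longleftrightarrow> bij_betw \<pi> {1..} S"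

definition monotone_ap3_free :: "(nat \<Rightarrow> nat) \<Rightarrow> bool" where
  "monotone_ap3_free \<pi> \<longleftrightarrow>
     \<not> (\<exists>i j k. 1 \<le> i \<and> i < j \<and> j < k \<and> monotone_ap3 (\<pi> i) (\<pi> j) (\<pi> k))"

definition permutable3 :: "nat set \<Rightarrow> bool" where
  "permutable3 S \<longleftrightarrow> (\<exists>\<pi>. omega_permutation \<pi> S \<and> monotone_ap3_free \<pi>)"

definition S_A :: "nat set" where
  "S_A = (\<Union>k\<in>{k::nat. k \<ge> 2 \<and> even k}. {2 ^ (k - 1) <.. 2 ^ k})"

definition S_B :: "nat set" where
  "S_B = {1..} - S_A"

end

theory Submission
  imports Defs
begin

text \<open>
  An order without monotone 3-term progressions is alternating along every arithmetic progression.
  On a long interval this forces, for every odd \<open>q\<close> up to about a fifth of the length, one parity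
  class to precede the other at distance \<open>q\<close>. The same holds inside each parity class, and so on;
  chaining a few of these levels yields a small offset \<open>b\<close> whose element precedes all elements of
  opposite parity up to the far end of the interval. On the other hand, a fixed \<open>x \<in> S_A\<close> precedes
  all of \<open>(n, 2n]\<close> when \<open>n = 2 ^ (k - 1)\<close> is large, so for \<open>y\<close> near \<open>n\<close> the element \<open>2y - x\<close>, which
  lies near \<open>2n\<close>, has to precede \<open>y\<close>.
\<close>

section \<open>Orders that alternate along arithmetic progressions\<close>

text \<open>Here \<open>p i\<close> plays the position of the \<open>i\<close>-th element of an
  interval. Together with injectivity, the equivalence makes the middle term of each progression
  come before both outer terms or after both. Integer values of \<open>p\<close> let an order be
  reversed by negation.\<close>

definition zigzag :: "(int \<Rightarrow> int) \<Rightarrow> int \<Rightarrow> bool" where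
  "zigzag p N \<longleftrightarrow> inj_on p {0..N} \<and>
     (\<forall>a d. d \<noteq> 0 \<longrightarrow> a \<in> {0..N} \<longrightarrow> a + 2 * d \<in> {0..N} \<longrightarrow>
        (p a < p (a + d) \<longleftrightarrow> p (a + 2 * d) < p (a + d)))"

lemma zigzag_alternates:
  assumes "zigzag p N" "d \<noteq> 0" "a \<in> {0..N}" "a + 2 * d \<in> {0..N}"
  shows "p a < p (a + d) \<longleftrightarrow> p (a + 2 * d) < p (a + d)"
  using assms unfolding zigzag_def by blast

lemma zigzag_neq:
  assumes "zigzag p N" "a \<in> {0..N}" "b \<in> {0..N}" "a \<noteq> b"
  shows "p a \<noteq> p b"
  using assms unfolding zigzag_def inj_on_def by blast

lemma zigzag_uminus:
  assumes "zigzag p N"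
  shows "zigzag (\<lambda>i. - p i) N"
proof -
  have "- p a < - p (a + d) \<longleftrightarrow> - p (a + 2 * d) < - p (a + d)"
    if "d \<noteq> 0" "a \<in> {0..N}" "a + 2 * d \<in> {0..N}" for a d
  proof -
    have "a + d \<in> {0..N}" using that by auto
    then have "p a \<noteq> p (a + d)" "p (a + 2 * d) \<noteq> p (a + d)"
      using zigzag_neq[OF assms] that by auto
    with zigzag_alternates[OF assms that] show ?thesis by linarith
  qed
  moreover have "inj_on (\<lambda>i. - p i) {0..N}"
    using assms unfolding zigzag_def inj_on_def by simp
  ultimately show ?thesis unfolding zigzag_def by blast
qed

lemma zigzag_sublattice:
  assumes "zigzag p N" "r \<in> {0, 1}"
  shows "zigzag (\<lambda>i. p (2 * i + r)) ((N - r) div 2)"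
proof -
  have range: "2 * i + r \<in> {0..N}" if "i \<in> {0..(N - r) div 2}" for i
    using that assms(2) by auto
  have "p (2 * a + r) < p (2 * (a + d) + r) \<longleftrightarrow> p (2 * (a + 2 * d) + r) < p (2 * (a + d) + r)"
    if "d \<noteq> 0" "a \<in> {0..(N - r) div 2}" "a + 2 * d \<in> {0..(N - r) div 2}" for a d
    using zigzag_alternates[OF assms(1), of "2 * d" "2 * a + r"] range[OF that(2)] range[OF that(3)]
      that(1) by (simp add: algebra_simps)
  moreover have "inj_on (\<lambda>i. p (2 * i + r)) {0..(N - r) div 2}"
  proof (rule inj_onI)
    fix i j assume "i \<in> {0..(N - r) div 2}" "j \<in> {0..(N - r) div 2}" "p (2 * i + r) = p (2 * j + r)"
    then show "i = j" using zigzag_neq[OF assms(1) range range, of i j] by auto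
  qed
  ultimately show ?thesis unfolding zigzag_def by blast
qed

section \<open>One parity class precedes the other at bounded odd distances\<close>

lemma zigzag_neighbours:
  assumes z: "zigzag p N" and "0 \<le> c" "c + 1 \<le> N"
  shows "p c < p (c + 1) \<longleftrightarrow> (p 0 < p 1 \<longleftrightarrow> even c)"
  using assms(2,3)
proof (induction c rule: int_ge_induct)
  case base
  then show ?case by simp
next
  case (step c)
  have "p (c + 1) \<noteq> p (c + 2)" by (rule zigzag_neq[OF z]) (use step in auto)
  moreover have "p c < p (c + 1) \<longleftrightarrow> p (c + 2) < p (c + 1)"
    using zigzag_alternates[OF z, of 1 c] step by simp
  ultimately have "p (c + 1) < p (c + 2) \<longleftrightarrow> \<not> p c < p (c + 1)" by linarith
  then show ?case using step by (simp add: add.assoc)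
qed

lemma zigzag_neighbours':
  assumes z: "zigzag p N" and "a \<in> {0..N}" "b \<in> {0..N}" "\<bar>a - b\<bar> = 1"
  shows "p a < p b \<longleftrightarrow> (p 0 < p 1 \<longleftrightarrow> even a)"
proof (cases "b = a + 1")
  case True
  then show ?thesis using zigzag_neighbours[OF z, of a] assms by auto
next
  case False
  then have a: "a = b + 1" using assms by auto
  have "p b < p a \<longleftrightarrow> (p 0 < p 1 \<longleftrightarrow> even b)"
    using zigzag_neighbours[OF z, of b] assms a by auto
  moreover have "p a \<noteq> p b" using zigzag_neq[OF z] assms by auto
  ultimately show ?thesis using a by auto
qed

text \<open>If \<open>c + q\<close> preceded \<open>c\<close>, alternation would put it before
  \<open>c + 2 * q\<close> too. Both neighbours of \<open>c + q\<close> precede it, so the step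
  \<open>2 * q'\<close> would lead to an earlier element from \<open>c\<close> but to a later one
  from \<open>c + 2 * m\<close>, against \<open>same\<close>.\<close>

lemma zigzag_parity_step:
  assumes z: "zigzag p N" and q: "odd q" "\<bar>q\<bar> \<ge> 3"
    and c: "c \<in> {0..N}" "c + 2 * q \<in> {0..N}" and early: "p 0 < p 1 \<longleftrightarrow> even c"
    and same: "\<And>q' m. odd q' \<Longrightarrow> even m \<Longrightarrow> \<bar>2 * q' - q\<bar> \<le> 1 \<Longrightarrow> q = q' + m \<Longrightarrow>
      p c < p (c + 2 * q') \<longleftrightarrow> p (c + 2 * m) < p (c + 2 * q)"
  shows "p c < p (c + q)"
proof (rule ccontr)
  assume neg: "\<not> p c < p (c + q)"
  have cq: "c + q \<in> {0..N}" using c by auto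
  have "p c \<noteq> p (c + q)" by (rule zigzag_neq[OF z c(1) cq]) (use q in auto)
  with neg have gt: "p (c + q) < p c" by linarith
  have "p (c + q) \<noteq> p (c + 2 * q)" by (rule zigzag_neq[OF z cq c(2)]) (use q in auto)
  with zigzag_alternates[OF z _ c] neg q(2) have lt: "p (c + q) < p (c + 2 * q)" by fastforce
  \<comment> \<open>The two halves of \<open>q\<close> are consecutive integers, one odd and one
    even, so \<open>c + 2 * q'\<close> and \<open>c + 2 * m\<close> are the two neighbours of
    \<open>c + q\<close>.\<close>
  obtain q' m where qm: "odd q'" "even m" "\<bar>2 * q' - q\<bar> \<le> 1" "q = q' + m"
  proof (cases "odd ((q - 1) div 2)")
    case True
    show ?thesis
      by (rule that[of "(q - 1) div 2" "(q + 1) div 2"]) (use True q(1) in presburger)+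
  next
    case False
    show ?thesis
      by (rule that[of "(q + 1) div 2" "(q - 1) div 2"]) (use False q(1) in presburger)+
  qed
  have close: "\<bar>c + 2 * q' - (c + q)\<bar> = 1" "\<bar>c + 2 * m - (c + q)\<bar> = 1"
    using qm q(1) by presburger+
  have in_range: "c + 2 * q' \<in> {0..N}" "c + 2 * m \<in> {0..N}"
    using close c q(2) by auto
  have below: "p (c + 2 * q') < p (c + q)" "p (c + 2 * m) < p (c + q)"
    using zigzag_neighbours'[OF z in_range(1) cq close(1)]
      zigzag_neighbours'[OF z in_range(2) cq close(2)] early by auto
  then have "\<not> p c < p (c + 2 * q')" using gt by linarith
  then have "\<not> p (c + 2 * m) < p (c + 2 * q)" using same[OF qm] by simp
  with below lt show False by linarith
qed

text \<open>
  The additive constant 7 is what makes the hypothesis on \<open>q\<close> pass to the parity classes of the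
  interval, whose lengths lose a unit to rounding.
\<close>

lemma zigzag_parity:
  assumes "zigzag p N" "odd q" "c \<in> {0..N}" "c + q \<in> {0..N}" "5 * \<bar>q\<bar> \<le> N + 7"
  shows "p c < p (c + q) \<longleftrightarrow> (p 0 < p 1 \<longleftrightarrow> even c)"
  using assms
proof (induction "nat \<bar>q\<bar>" arbitrary: p N q c rule: less_induct)
  case less
  note z = less.prems(1) and oddq = less.prems(2) and len = less.prems(5)
  show ?case
  proof (cases "\<bar>q\<bar> = 1")
    case True
    then show ?thesis by (intro zigzag_neighbours'[OF z]) (use less.prems in auto)
  next
    case False
    then have q3: "\<bar>q\<bar> \<ge> 3" using oddq by presburger
    \<comment> \<open>Inside the parity class of \<open>a\<close>, both sides are steps by
      \<open>q'\<close>, starting at \<open>a0\<close> and at \<open>a0 + m\<close>. These starting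
      points have equal parity, so the induction hypothesis decides both alike.\<close>
    have same: "g a < g (a + 2 * q') \<longleftrightarrow> g (a + 2 * m) < g (a + 2 * s)"
      if "zigzag g N" "a \<in> {0..N}" "a + 2 * s \<in> {0..N}" "\<bar>s\<bar> = \<bar>q\<bar>"
        and q': "odd q'" "even m" "\<bar>2 * q' - s\<bar> \<le> 1" "s = q' + m" for g a s q' m
    proof -
      define r where "r = a mod 2"
      define a0 where "a0 = a div 2"
      have a: "a = 2 * a0 + r" and r: "r \<in> {0, 1}" unfolding r_def a0_def by auto
      define h where "h i = g (2 * i + r)" for i
      have zh: "zigzag h ((N - r) div 2)"
        unfolding h_def by (rule zigzag_sublattice[OF that(1) r])
      have small: "nat \<bar>q'\<bar> < nat \<bar>q\<bar>" using q' that(4) q3 by linarith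
      have len': "5 * \<bar>q'\<bar> \<le> (N - r) div 2 + 7" using q' that(4) len r by auto
      have ends: "a0 \<in> {0..(N - r) div 2}" "a0 + s \<in> {0..(N - r) div 2}"
        using that(2,3) a r by auto
      have inner: "a0 + q' \<in> {0..(N - r) div 2}" "a0 + m \<in> {0..(N - r) div 2}"
        using ends q' that(4) q3 by auto
      have "h a0 < h (a0 + q') \<longleftrightarrow> (h 0 < h 1 \<longleftrightarrow> even a0)"
        by (rule less.hyps[OF small zh q'(1) ends(1) inner(1) len'])
      moreover have "h (a0 + m) < h (a0 + m + q') \<longleftrightarrow> (h 0 < h 1 \<longleftrightarrow> even (a0 + m))"
        by (rule less.hyps[OF small zh q'(1) inner(2) _ len']) (use ends q'(4) in \<open>simp add: ac_simps\<close>)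
      ultimately show ?thesis using q'(2,4) by (simp add: h_def a algebra_simps)
    qed
    have core: "p a < p (a + s) \<longleftrightarrow> (p 0 < p 1 \<longleftrightarrow> even a)"
      if s: "\<bar>s\<bar> = \<bar>q\<bar>" and a: "a \<in> {0..N}" "a + 2 * s \<in> {0..N}" for a s
    proof -
      have odds: "odd s" and s3: "\<bar>s\<bar> \<ge> 3" using s oddq q3 by presburger+
      show ?thesis
      proof (cases "p 0 < p 1 \<longleftrightarrow> even a")
        case True
        then show ?thesis
          using zigzag_parity_step[OF z odds s3 a True same[OF z a s]] by blast
      next
        case False
        \<comment> \<open>Reversing the order turns the late class into the early one.\<close>
        have "p 0 \<noteq> p 1" by (rule zigzag_neq[OF z]) (use len q3 in auto)
        with False have "- p 0 < - p 1 \<longleftrightarrow> even a" by linarith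
        then have "- p a < - p (a + s)"
          using zigzag_parity_step[OF zigzag_uminus[OF z] odds s3 a _ same[OF zigzag_uminus[OF z] a s]]
          by blast
        then show ?thesis using False by auto
      qed
    qed
    show ?thesis
    proof (cases "c + 2 * q \<in> {0..N}")
      case True
      then show ?thesis using core less.prems by blast
    next
      case False
      \<comment> \<open>If \<open>c + 2 * q\<close> and \<open>c - q\<close> both left the interval,
        then \<open>3 * \<bar>q\<bar> \<ge> N + 2\<close>, which is incompatible with the length
        bound once \<open>\<bar>q\<bar> \<ge> 3\<close>.\<close>
      then have "c - q \<in> {0..N}" using less.prems q3 by auto
      then have "p (c + q) < p c \<longleftrightarrow> (p 0 < p 1 \<longleftrightarrow> even (c + q))"
        using core[of "- q" "c + q"] less.prems by (simp add: algebra_simps)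
      moreover have "p (c + q) \<noteq> p c" by (rule zigzag_neq[OF z]) (use less.prems q3 in auto)
      ultimately show ?thesis using oddq by auto
    qed
  qed
qed

section \<open>A small offset that comes early\<close>

text \<open>Each additional level extends the reach of the early element by a sixth of the length.\<close>

lemma zigzag_early_element:
  "\<exists>C\<ge>0. \<forall>N p. zigzag p N \<longrightarrow> N \<ge> C \<longrightarrow>
     (\<exists>b\<in>{0..<2 ^ h}. \<forall>t\<in>{0..N}. odd (t - b) \<longrightarrow> 6 * t \<le> int h * N - C \<longrightarrow> p b < p t)"
proof (induction h)
  \<comment> \<open>With constant 1 the bound on \<open>t\<close> is negative, so the claim is
    vacuous.\<close>
  case 0
  show ?case by (rule exI[of _ 1]) auto
next
  case (Suc h)
  then obtain C where C0: "C \<ge> 0" and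
    C: "\<And>N p. zigzag p N \<Longrightarrow> N \<ge> C \<Longrightarrow>
      \<exists>b\<in>{0..<2 ^ h}. \<forall>t\<in>{0..N}. odd (t - b) \<longrightarrow> 6 * t \<le> int h * N - C \<longrightarrow> p b < p t"
    by blast
  \<comment> \<open>\<open>2 * C\<close> accounts for the halved interval, \<open>2 * int h\<close>
    for the rounding in \<open>M\<close>, and \<open>10 * 2 ^ h\<close> gives
    \<open>5 * b \<le> N\<close>.\<close>
  define D where "D = 2 * C + 2 * int h + 100 + 10 * 2 ^ h"
  have "\<exists>b\<in>{0..<2 ^ Suc h}. \<forall>t\<in>{0..N}. odd (t - b) \<longrightarrow> 6 * t \<le> int (Suc h) * N - D \<longrightarrow> p b < p t"
    if z: "zigzag p N" and N: "N \<ge> D" for N p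
  proof -
    define r :: int where "r = (if p 0 < p 1 then 0 else 1)"
    have r: "r \<in> {0, 1}" unfolding r_def by simp
    have early: "p 0 < p 1 \<longleftrightarrow> even r" unfolding r_def by simp
    have pw: "(2::int) ^ h > 0" by simp
    define M where "M = (N - r) div 2"
    have "N \<ge> 2 * C + 2" using N C0 pw unfolding D_def by linarith
    then have "M \<ge> C" using r unfolding M_def by auto
    moreover have "zigzag (\<lambda>i. p (2 * i + r)) M"
      unfolding M_def by (rule zigzag_sublattice[OF z r])
    ultimately obtain b' where b': "b' \<in> {0..<2 ^ h}" and
      IH: "\<And>t. t \<in> {0..M} \<Longrightarrow> odd (t - b') \<Longrightarrow> 6 * t \<le> int h * M - C \<Longrightarrow>
        p (2 * b' + r) < p (2 * t + r)"
      using C by blast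
    define b where "b = 2 * b' + r"
    have b: "b \<in> {0..<2 ^ Suc h}" unfolding b_def using b' r by auto
    have bN: "b \<in> {0..N}" "10 * b \<le> 2 * N" "b < 2 * 2 ^ h"
      using b N C0 pw unfolding D_def by auto
    have step: "p a < p t" if "a \<in> {0..N}" "t \<in> {0..N}" "even (a - r)" "odd (t - a)"
      "5 * \<bar>t - a\<bar> \<le> N + 7" for a t
      using zigzag_parity[OF z that(4), of a] that early by auto
    have "p b < p t" if t: "t \<in> {0..N}" "odd (t - b)" "6 * t \<le> int (Suc h) * N - D" for t
    proof (cases "6 * t \<le> N")
      case True
      have "5 * t \<le> N" "5 * b \<le> N" "0 \<le> t" "0 \<le> b" using True t(1) bN by auto
      then have "5 * \<bar>t - b\<bar> \<le> N + 7" by (cases "b \<le> t") auto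
      then show ?thesis using step[of b t] bN(1) t by (simp add: b_def)
    next
      case False
      \<comment> \<open>The bridge \<open>2 * t' + r\<close> lies about \<open>N / 6\<close> below
        \<open>t\<close>: near enough for \<open>step\<close>, and within the reach of the
        hypothesis for the early class. The shift \<open>s\<close> makes the parity of
        \<open>t'\<close> opposite to that of \<open>b'\<close>.\<close>
      define s where "s = 1 - b' mod 2"
      have s: "s \<in> {0, 1}" unfolding s_def by auto
      define u where "u = (6 * t - N) div 24"
      have u: "24 * u \<le> 6 * t - N" "6 * t - N < 24 * u + 24" "u \<ge> 0"
        unfolding u_def using False by auto
      define t' where "t' = s + 2 * u"
      have N100: "N \<ge> 100" using N C0 pw unfolding D_def by linarith
      have t'N: "2 * t' + r \<in> {0..N}" using u s r t(1) N100 unfolding t'_def by auto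
      then have t'M: "t' \<in> {0..M}" unfolding M_def using s u by (auto simp: t'_def)
      have "int h * N \<le> int h * (2 * M + 2)"
        by (rule mult_left_mono) (use r in \<open>auto simp: M_def\<close>)
      then have "int h * N \<le> 2 * (int h * M) + 2 * int h" by (simp add: algebra_simps)
      moreover have "12 * t' \<le> 12 + int h * N - D"
      proof -
        have "int (Suc h) * N = int h * N + N" by (simp add: algebra_simps)
        moreover have "t' \<le> 1 + 2 * u" using s unfolding t'_def by auto
        ultimately show ?thesis using u(1) t(3) by linarith
      qed
      ultimately have "6 * t' \<le> int h * M - C" using pw unfolding D_def by linarith
      moreover have "odd (t' - b')" unfolding t'_def s_def by presburger
      ultimately have "p b < p (2 * t' + r)" unfolding b_def using IH t'M by blast
      also have "\<dots> < p t"
      proof (rule step[OF t'N t(1)])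
        show "odd (t - (2 * t' + r))" using t(2) unfolding b_def by presburger
        show "5 * \<bar>t - (2 * t' + r)\<bar> \<le> N + 7"
          using u(1,2) s r N100 unfolding t'_def by (elim insertE; simp; linarith)
      qed simp
      finally show ?thesis .
    qed
    then show ?thesis using b by blast
  qed
  moreover have "D \<ge> 0" using C0 unfolding D_def by simp
  ultimately show ?case by blast
qed

section \<open>Application to the dyadic blocks of \<open>S_A\<close>\<close>

lemma S_A_block:
  assumes "even k" "k \<ge> 2" "2 ^ (k - 1) < x" "x \<le> 2 ^ k"
  shows "x \<in> S_A"
  using assms unfolding S_A_def by auto

text \<open>Each progression in the block is monotone read in either direction, so its middle term
  cannot lie between the outer ones in position.\<close>

lemma positions_zigzag:
  assumes bij: "bij_betw \<pi> {1..} S" and free: "monotone_ap3_free \<pi>" and block: "{n<..2 * n} \<subseteq> S"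
  shows "zigzag (\<lambda>i. int (inv_into {1..} \<pi> (n + 1 + nat i))) (int n - 1)"
proof -
  define pos where "pos = inv_into {1..} \<pi>"
  have pos: "pos x \<in> {1..}" "\<pi> (pos x) = x" if "x \<in> S" for x
    using that bij unfolding pos_def
    by (metis bij_betw_imp_surj_on inv_into_into, metis bij_betw_inv_into_right)
  have elem: "n + 1 + nat i \<in> S" if "i \<in> {0..int n - 1}" for i
    using that block by auto
  have inj: "pos x \<noteq> pos y" if "x \<in> S" "y \<in> S" "x \<noteq> y" for x y
    using pos(2)[OF that(1)] pos(2)[OF that(2)] that(3) by metis
  have no_ap: "\<not> (pos x < pos y \<and> pos y < pos z)" if "x \<in> S" "y \<in> S" "z \<in> S"
    "monotone_ap3 x y z" for x y z
  proof -
    have "1 \<le> pos x" using pos(1)[OF that(1)] by simp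
    moreover have "monotone_ap3 (\<pi> (pos x)) (\<pi> (pos y)) (\<pi> (pos z))"
      using that by (simp add: pos(2))
    ultimately show ?thesis using free unfolding monotone_ap3_free_def by blast
  qed
  have "pos (n + 1 + nat a) < pos (n + 1 + nat (a + d)) \<longleftrightarrow>
      pos (n + 1 + nat (a + 2 * d)) < pos (n + 1 + nat (a + d))"
    if d: "d \<noteq> 0" and a: "a \<in> {0..int n - 1}" "a + 2 * d \<in> {0..int n - 1}" for a d
  proof -
    let ?x = "n + 1 + nat a" and ?y = "n + 1 + nat (a + d)" and ?z = "n + 1 + nat (a + 2 * d)"
    have "a + d \<in> {0..int n - 1}" using a by auto
    then have S: "?x \<in> S" "?y \<in> S" "?z \<in> S" using elem a by blast+
    have "?x \<noteq> ?y" "?z \<noteq> ?y" using a d by auto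
    then have "pos ?x \<noteq> pos ?y" "pos ?z \<noteq> pos ?y" using inj S by blast+
    moreover have "monotone_ap3 ?x ?y ?z" "monotone_ap3 ?z ?y ?x"
      using a d unfolding monotone_ap3_def ap3_def by auto
    then have "\<not> (pos ?x < pos ?y \<and> pos ?y < pos ?z)" "\<not> (pos ?z < pos ?y \<and> pos ?y < pos ?x)"
      using no_ap S by blast+
    ultimately show ?thesis by linarith
  qed
  moreover have "inj_on (\<lambda>i. int (pos (n + 1 + nat i))) {0..int n - 1}"
  proof (rule inj_onI)
    fix i j assume ij: "i \<in> {0..int n - 1}" "j \<in> {0..int n - 1}"
      and "int (pos (n + 1 + nat i)) = int (pos (n + 1 + nat j))"
    then have "n + 1 + nat i = n + 1 + nat j"
      using inj[OF elem[OF ij(1)] elem[OF ij(2)]] by (metis of_nat_eq_iff)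
    then show "i = j" using ij by auto
  qed
  ultimately show ?thesis unfolding zigzag_def pos_def by simp
qed

lemma not_permutable3_S_A: "\<not> permutable3 S_A"
proof
  assume "permutable3 S_A"
  then obtain \<pi> where bij: "bij_betw \<pi> {1..} S_A" and free: "monotone_ap3_free \<pi>"
    unfolding permutable3_def omega_permutation_def by blast
  define pos where "pos = inv_into {1..} \<pi>"
  have pos: "pos x \<in> {1..}" "\<pi> (pos x) = x" if "x \<in> S_A" for x
    using that bij unfolding pos_def
    by (metis bij_betw_imp_surj_on inv_into_into, metis bij_betw_inv_into_right)
  \<comment> \<open>Seven levels reach \<open>7 * N / 6\<close>, beyond the whole interval, and keep
    \<open>b < 128\<close>.\<close>
  obtain C where C: "\<And>N p. zigzag p N \<Longrightarrow> N \<ge> C \<Longrightarrow>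
      \<exists>b\<in>{0..<2 ^ 7}. \<forall>t\<in>{0..N}. odd (t - b) \<longrightarrow> 6 * t \<le> int 7 * N - C \<longrightarrow> p b < p t"
    using zigzag_early_element[of 7] by blast
  \<comment> \<open>Every element of \<open>S_A\<close> above \<open>W\<close> comes after both 513
    and 514.\<close>
  define W where "W = Max (\<pi> ` {..max (pos 513) (pos 514)})"
  have early: "x \<le> W" if "x \<in> S_A" "pos x \<le> max (pos 513) (pos 514)" for x
  proof -
    have "x \<in> \<pi> ` {..max (pos 513) (pos 514)}"
      using pos(2)[OF that(1)] that(2) by (metis atMost_iff image_eqI)
    then show ?thesis unfolding W_def by simp
  qed
  define k where "k = 2 * (W + nat C + 1000)"
  define n :: nat where "n = 2 ^ (k - 1)"
  have k: "even k" "k \<ge> 2" unfolding k_def by auto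
  then have n2: "2 ^ k = 2 * n" unfolding n_def by (cases k) auto
  have block: "{n<..2 * n} \<subseteq> S_A" using S_A_block[OF k] n2 unfolding n_def by auto
  have "k - 1 < n" unfolding n_def by simp
  then have big: "W < n" "nat C < n" "1000 < n" unfolding k_def by auto
  have evn: "even n" unfolding n_def k_def by simp
  define N where "N = int n - 1"
  have N: "N \<ge> C" "odd N" "N \<ge> 1000" using big evn unfolding N_def by auto
  obtain b where b: "b \<in> {0..<2 ^ 7}" and
    first: "\<And>t. t \<in> {0..N} \<Longrightarrow> odd (t - b) \<Longrightarrow> 6 * t \<le> int 7 * N - C \<Longrightarrow>
      int (pos (n + 1 + nat b)) < int (pos (n + 1 + nat t))"
    using C[OF positions_zigzag[OF bij free block]] N(1) unfolding N_def pos_def by blast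
  \<comment> \<open>Since \<open>N\<close> is odd, \<open>x\<close> must have the parity of
    \<open>b\<close> for \<open>t - b\<close> to be odd. Both candidates exceed
    \<open>2 + 2 * b\<close>, which keeps \<open>t\<close> below \<open>N\<close>.\<close>
  define x :: nat where "x = (if even b then 514 else 513)"
  have "x \<in> S_A" by (rule S_A_block[of 10]) (auto simp: x_def)
  \<comment> \<open>This makes \<open>n + 1 + t\<close> the reflection of \<open>x\<close> in
    \<open>n + 1 + b\<close>.\<close>
  define t where "t = N + 2 + 2 * b - int x"
  have t: "t \<in> {0..N}" using b N unfolding t_def x_def by auto
  have "odd (t - b)" unfolding t_def x_def using N(2) by auto
  moreover have "6 * t \<le> int 7 * N - C" using t N by auto
  ultimately have yz: "pos (n + 1 + nat b) < pos (n + 1 + nat t)" using first t by simp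
  have mem: "n + 1 + nat b \<in> S_A" "n + 1 + nat t \<in> S_A"
    using block b t N unfolding N_def by auto
  have "pos x < pos (n + 1 + nat b)"
    using early[OF mem(1)] big(1) unfolding x_def by fastforce
  moreover have "monotone_ap3 x (n + 1 + nat b) (n + 1 + nat t)"
    using b t N unfolding monotone_ap3_def ap3_def t_def x_def N_def by auto
  ultimately show False
    using free yz pos \<open>x \<in> S_A\<close> mem unfolding monotone_ap3_free_def by (metis atLeast_iff)
qed

lemma partition_S_A_S_B: "partition_on {1..} {S_A, S_B}"
proof -
  have "3 \<in> S_A" by (rule S_A_block[of 2]) auto
  moreover have "S_A \<subseteq> {1..}" unfolding S_A_def by auto
  moreover have "1 \<notin> S_A" unfolding S_A_def by (auto simp: not_less)
  then have "1 \<in> S_B" unfolding S_B_def by auto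
  ultimately show ?thesis
    unfolding partition_on_def disjoint_def S_B_def by auto
qed

theorem theorem21:
  shows "\<not> permutable3 S_A \<and>
         partition_on {1..} {S_A, S_B} \<and> \<not> (permutable3 S_A \<and> permutable3 S_B)"
  using not_permutable3_S_A partition_S_A_S_B by blast

end
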